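(* An oriented graph is a local K-graph if and only if it is a K-graph.
   Context: **Digraphs.** A digraph is an irreflexive binary relation $D$ on a finite nonempty set, the set of vertices of $D$. The ordered pairs in $D$ are its edges; an edge $(a,b)$ begins in $a$ and ends in $b$. An oriented graph is an antisymmetric digraph (if $(a,b)\in D$ then $(b,a)\notin D$). A W-vertex of $D$ is a vertex in which no edge ends; an E-vertex is a vertex in which no edge begins; an inner vertex is one that is neither. A W-edge is an edge beginning in a W-vertex; an E-edge is an edge ending in an E-vertex. A W-edge $(a,b)$ is functional when $(a,c)\in D$ implies $c=b$; an E-edge $(b,a)$ is functional when $(c,a)\in D$ implies $c=b$. **Semipaths.** For $n\ge 1$ consider a sequence $a_1,\dots,a_n$ of vertices such that for every $i\in\{1,\dots,n-1\}$ we have $(a_i,a_{i+1})\in D$ or $(a_{i+1},a_i)\in D$. It is a semipath when all its vertices are mutually distinct (joining $a_1$ to $a_n$); it is a semicycle when $a_1=a_n$, $n\ge 4$, and $a_1,\dots,a_{n-1}$ are mutually distinct. A path is a semipath with $(a_i,a_{i+1})\in D$ for every $i\in\{1,\dots,n-1\}$. The cognate of a semipath is the same sequence in inverse order. $D$ is weakly connected when every two vertices are joined by a semipath; asemicyclic when it has no semicycles; W-E-functional when all its W-edges and E-edges are functional. **Local K-graphs.** For a digraph $D$ let $\mathcal{L}$ be a set of four functions $NW,SW,NE,SE$ on the inner vertices of $D$ such that, for $Y\in\{N,S\}$ and every inner vertex $a$, $YW(a)$ is an edge of $D$ of the form $(b,a)$ and $YE(a)$ is an edge of $D$ of the form $(a,b)$.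 For an inner vertex $a$ let $k^a_W$ be the number of edges ending in $a$ and $k^a_E$ the number of edges beginning in $a$. $\langle D,\mathcal{L}\rangle$ separates $N$ from $S$ when for every inner vertex $a$ and every $X\in\{W,E\}$: if $k^a_X\ge 2$ then $NX(a)\ne SX(a)$. A path $a_1,\dots,a_n$ of $D$ is $Y$-decent in $\langle D,\mathcal{L}\rangle$ when $n=1$, or $n\ge 2$ and [$YE(a_1)=(a_1,a_2)$ or $YW(a_n)=(a_{n-1},a_n)$] (an equality involving a function at a vertex that is not inner counts as false); it is decent when it is both $N$-decent and $S$-decent. For an oriented graph $D$, $\langle D,\mathcal{L}\rangle$ is a local compass graph when $D$ is weakly connected, asemicyclic, W-E-functional and has an inner vertex, $\langle D,\mathcal{L}\rangle$ separates $N$ from $S$, and every path of $D$ all of whose vertices are inner is decent in $\langle D,\mathcal{L}\rangle$. An oriented graph $D$ is a local K-graph when $\langle D,\mathcal{L}\rangle$ is a local compass graph for some $\mathcal{L}$. **K-graphs.** A proper semipath is a semipath such that neither it nor its cognate is a path. An edge $(a,b)$ of an oriented graph is transversal when there is a proper semipath $a,b,\dots,c$ (starting with $a,b$) and a proper semipath $b,a,\dots,d$ (starting with $b,a$). A bifurcation is a triple of different edges that have a common vertex; it is transversal when all three edges in it are transversal. A K-graph is an oriented graph that is weakly connected, asemicyclic, W-E-functional, has an inner vertex, and in which no bifurcation is transversal. *)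

theory Defs
  imports "Graph_Theory.Pair_Digraph"
begin

section \<open>Oriented graphs\<close>

text \<open>
  A digraph is a finite, loop-free \<^typ>\<open>'a pair_pre_digraph\<close> with at least one vertex;
  \<^const>\<open>pair_digraph\<close> alone allows the empty vertex set. For an irreflexive relation
  antisymmetry is the same as \<^const>\<open>asym\<close>.
\<close>

definition oriented_graph :: "'a pair_pre_digraph \<Rightarrow> bool" where
  "oriented_graph D \<longleftrightarrow> pair_digraph D \<and> pverts D \<noteq> {} \<and> asym (parcs D)"

definition W_vertex :: "'a pair_pre_digraph \<Rightarrow> 'a \<Rightarrow> bool" where
  "W_vertex D a \<longleftrightarrow> a \<in> pverts D \<and> in_arcs D a = {}"

definition E_vertex :: "'a pair_pre_digraph \<Rightarrow> 'a \<Rightarrow> bool" where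
  "E_vertex D a \<longleftrightarrow> a \<in> pverts D \<and> out_arcs D a = {}"

definition inner_vertex :: "'a pair_pre_digraph \<Rightarrow> 'a \<Rightarrow> bool" where
  "inner_vertex D a \<longleftrightarrow> a \<in> pverts D \<and> \<not> W_vertex D a \<and> \<not> E_vertex D a"

definition W_E_functional :: "'a pair_pre_digraph \<Rightarrow> bool" where
  "W_E_functional D \<longleftrightarrow>
     (\<forall>a b. (a, b) \<in> parcs D \<and> W_vertex D a \<longrightarrow> (\<forall>c. (a, c) \<in> parcs D \<longrightarrow> c = b)) \<and>
     (\<forall>a b. (b, a) \<in> parcs D \<and> E_vertex D a \<longrightarrow> (\<forall>c. (c, a) \<in> parcs D \<longrightarrow> c = b))"


section \<open>Semipaths\<close>

text \<open>
  A sequence \<open>a\<^sub>1, \<dots>, a\<^sub>n\<close> of vertices (\<open>n \<ge> 1\<close>) is a nonempty list; the cognate of a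
  semipath \<open>p\<close> is \<^term>\<open>rev p\<close>.
\<close>

definition adjacent_seq :: "'a pair_pre_digraph \<Rightarrow> 'a list \<Rightarrow> bool" where
  "adjacent_seq D p \<longleftrightarrow> p \<noteq> [] \<and> set p \<subseteq> pverts D \<and>
     successively (\<lambda>a b. (a, b) \<in> parcs D \<or> (b, a) \<in> parcs D) p"

definition semipath :: "'a pair_pre_digraph \<Rightarrow> 'a list \<Rightarrow> bool" where
  "semipath D p \<longleftrightarrow> adjacent_seq D p \<and> distinct p"

definition semicycle :: "'a pair_pre_digraph \<Rightarrow> 'a list \<Rightarrow> bool" where
  "semicycle D p \<longleftrightarrow>
     adjacent_seq D p \<and> hd p = last p \<and> length p \<ge> 4 \<and> distinct (butlast p)"

definition dipath :: "'a pair_pre_digraph \<Rightarrow> 'a list \<Rightarrow> bool" where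
  "dipath D p \<longleftrightarrow> semipath D p \<and> successively (\<lambda>a b. (a, b) \<in> parcs D) p"

definition weakly_connected :: "'a pair_pre_digraph \<Rightarrow> bool" where
  "weakly_connected D \<longleftrightarrow>
     (\<forall>a\<in>pverts D. \<forall>b\<in>pverts D. \<exists>p. semipath D p \<and> hd p = a \<and> last p = b)"

definition asemicyclic :: "'a pair_pre_digraph \<Rightarrow> bool" where
  "asemicyclic D \<longleftrightarrow> \<not> (\<exists>p. semicycle D p)"


section \<open>Local K-graphs\<close>

text \<open>
  The four functions \<open>NW\<close>, \<open>SW\<close>, \<open>NE\<close>, \<open>SE\<close> are packed into a single function
  \<open>L\<close>, with \<open>L Y X\<close> standing for \<open>YX\<close>. Its values at vertices that are not inner
  carry no information and are never consulted.
\<close>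

datatype pole = North | South
datatype side = West | East

type_synonym 'a compass = "pole \<Rightarrow> side \<Rightarrow> 'a \<Rightarrow> 'a \<times> 'a"

definition compass_functions :: "'a pair_pre_digraph \<Rightarrow> 'a compass \<Rightarrow> bool" where
  "compass_functions D L \<longleftrightarrow>
     (\<forall>Y a. inner_vertex D a \<longrightarrow> L Y West a \<in> in_arcs D a \<and> L Y East a \<in> out_arcs D a)"

fun side_degree :: "'a pair_pre_digraph \<Rightarrow> side \<Rightarrow> 'a \<Rightarrow> nat" where
  "side_degree D West a = in_degree D a"
| "side_degree D East a = out_degree D a"

definition separates :: "'a pair_pre_digraph \<Rightarrow> 'a compass \<Rightarrow> bool" where
  "separates D L \<longleftrightarrow>
     (\<forall>X a. inner_vertex D a \<and> side_degree D X a \<ge> 2 \<longrightarrow> L North X a \<noteq> L South X a)"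

definition pole_decent :: "'a pair_pre_digraph \<Rightarrow> 'a compass \<Rightarrow> pole \<Rightarrow> 'a list \<Rightarrow> bool" where
  "pole_decent D L Y p \<longleftrightarrow>
     length p = 1 \<or>
     length p \<ge> 2 \<and>
     (inner_vertex D (p ! 0) \<and> L Y East (p ! 0) = (p ! 0, p ! 1) \<or>
      inner_vertex D (p ! (length p - 1)) \<and>
        L Y West (p ! (length p - 1)) = (p ! (length p - 2), p ! (length p - 1)))"

definition decent :: "'a pair_pre_digraph \<Rightarrow> 'a compass \<Rightarrow> 'a list \<Rightarrow> bool" where
  "decent D L p \<longleftrightarrow> pole_decent D L North p \<and> pole_decent D L South p"

definition local_compass_graph :: "'a pair_pre_digraph \<Rightarrow> 'a compass \<Rightarrow> bool" where
  "local_compass_graph D L \<longleftrightarrow>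
     oriented_graph D \<and> compass_functions D L \<and>
     weakly_connected D \<and> asemicyclic D \<and> W_E_functional D \<and> (\<exists>a. inner_vertex D a) \<and>
     separates D L \<and>
     (\<forall>p. dipath D p \<and> (\<forall>a\<in>set p. inner_vertex D a) \<longrightarrow> decent D L p)"

definition local_K_graph :: "'a pair_pre_digraph \<Rightarrow> bool" where
  "local_K_graph D \<longleftrightarrow> oriented_graph D \<and> (\<exists>L. local_compass_graph D L)"


section \<open>K-graphs\<close>

definition proper_semipath :: "'a pair_pre_digraph \<Rightarrow> 'a list \<Rightarrow> bool" where
  "proper_semipath D p \<longleftrightarrow> semipath D p \<and> \<not> dipath D p \<and> \<not> dipath D (rev p)"

fun transversal_edge :: "'a pair_pre_digraph \<Rightarrow> 'a \<times> 'a \<Rightarrow> bool" where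
  "transversal_edge D (a, b) \<longleftrightarrow> (a, b) \<in> parcs D \<and>
     (\<exists>p. proper_semipath D (a # b # p)) \<and> (\<exists>q. proper_semipath D (b # a # q))"

definition bifurcation ::
    "'a pair_pre_digraph \<Rightarrow> 'a \<times> 'a \<Rightarrow> 'a \<times> 'a \<Rightarrow> 'a \<times> 'a \<Rightarrow> bool" where
  "bifurcation D e f g \<longleftrightarrow>
     {e, f, g} \<subseteq> parcs D \<and> distinct [e, f, g] \<and>
     (\<exists>v. \<forall>h\<in>{e, f, g}. v = fst h \<or> v = snd h)"

definition transversal_bifurcation ::
    "'a pair_pre_digraph \<Rightarrow> 'a \<times> 'a \<Rightarrow> 'a \<times> 'a \<Rightarrow> 'a \<times> 'a \<Rightarrow> bool" where
  "transversal_bifurcation D e f g \<longleftrightarrow>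
     bifurcation D e f g \<and> transversal_edge D e \<and> transversal_edge D f \<and> transversal_edge D g"

definition K_graph :: "'a pair_pre_digraph \<Rightarrow> bool" where
  "K_graph D \<longleftrightarrow>
     oriented_graph D \<and> weakly_connected D \<and> asemicyclic D \<and> W_E_functional D \<and>
     (\<exists>a. inner_vertex D a) \<and> \<not> (\<exists>e f g. transversal_bifurcation D e f g)"

end

theory Submission
  imports Defs
begin

text \<open>
  An edge is transversal iff it lies on a directed walk, called a thread here, from a vertex with
  at least two outgoing edges to a vertex with at least two incoming ones. Decency and separation
  together say that for every thread exactly one pole \<open>Z\<close> selects its first edge in the east of
  its first vertex, and that the opposite pole selects its last edge in the west of its last
  vertex. By exchanging the ends of threads, \<open>Z\<close> depends only on an edge of the thread. So a local
  compass amounts to a colouring of the transversal edges by poles such that two of them with a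
  common vertex have the same colour iff one ends where the other begins. Around a vertex, the
  colours of the outgoing and the opposite colours of the incoming transversal edges are then
  distinct poles, so that there are at most two of them. Conversely, when there are at most two
  at every vertex, the transversal edges form a forest of maximal degree two, and a colouring
  is found by removing an edge with a free end.
\<close>

section \<open>Walks, threads and leaves in forests\<close>

abbreviation arc_walk :: "('a \<times> 'a) set \<Rightarrow> 'a list \<Rightarrow> bool" where
  "arc_walk A \<equiv> successively (\<lambda>a b. (a, b) \<in> A)"

abbreviation semiwalk :: "('a \<times> 'a) set \<Rightarrow> 'a list \<Rightarrow> bool" where
  "semiwalk A \<equiv> successively (\<lambda>a b. (a, b) \<in> A \<or> (b, a) \<in> A)"

text \<open>Stated for a bare relation, with no vertex set, so that it passes to the converse
  relation and to the set of transversal edges.\<close>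

definition forest :: "('a \<times> 'a) set \<Rightarrow> bool" where
  "forest A \<longleftrightarrow> asym A \<and>
     \<not> (\<exists>p. semiwalk A p \<and> hd p = last p \<and> length p \<ge> 4 \<and> distinct (butlast p))"

text \<open>Indegree at least two, expressed without cardinalities. Applied to the converse
  relation, it is outdegree at least two.\<close>

definition joins :: "('a \<times> 'a) set \<Rightarrow> 'a \<Rightarrow> bool" where
  "joins A y \<longleftrightarrow> (\<exists>u v. u \<noteq> v \<and> (u, y) \<in> A \<and> (v, y) \<in> A)"

definition thread :: "('a \<times> 'a) set \<Rightarrow> 'a list \<Rightarrow> bool" where
  "thread A p \<longleftrightarrow> length p \<ge> 2 \<and> arc_walk A p \<and> joins (A\<inverse>) (hd p) \<and> joins A (last p)"

lemma forest_asym: "forest A \<Longrightarrow> (a, b) \<in> A \<Longrightarrow> (b, a) \<notin> A"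
  unfolding forest_def by (meson asymD)

lemma forest_converse: "forest A \<Longrightarrow> forest (A\<inverse>)"
  unfolding forest_def asym_on_def by (simp add: disj_commute)

lemma forest_subset:
  assumes "forest A" and "F \<subseteq> A"
  shows "forest F"
proof -
  have "semiwalk A p" if "semiwalk F p" for p
    using that by (rule successively_mono) (use assms(2) in auto)
  moreover have "asym F" using assms unfolding forest_def asym_on_def by blast
  ultimately show ?thesis using assms(1) unfolding forest_def by blast
qed

text \<open>A return to \<open>a\<close> would close a semicycle \<open>a, b, c, ..., a\<close>. The
  assumption \<open>a \<noteq> c\<close> rules out going straight back, so that this sequence has at
  least four entries.\<close>

lemma forest_semiwalk_Cons:
  assumes "forest A" and "distinct (b # c # q)" and "semiwalk A (a # b # c # q)" and "a \<noteq> c"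
  shows "a \<notin> set (b # c # q)"
proof
  assume "a \<in> set (b # c # q)"
  moreover have "a \<noteq> b" using assms forest_asym[OF assms(1)] by auto
  ultimately have "a \<in> set q" using assms by auto
  then obtain r s where q: "q = r @ a # s" by (meson split_list)
  let ?p = "a # b # c # r @ [a]"
  have "semiwalk A (?p @ s)" using assms(3) q by simp
  then have "semiwalk A ?p" using successively_append_iff by blast
  moreover have "hd ?p = last ?p" "length ?p \<ge> 4" by simp_all
  moreover have "distinct (butlast ?p)"
    using assms(2) \<open>a \<noteq> b\<close> \<open>a \<noteq> c\<close> q by (auto simp: butlast_append)
  ultimately show False using assms(1) unfolding forest_def by blast
qed

lemma arc_walk_semiwalk: "arc_walk A p \<Longrightarrow> semiwalk A p"
  by (erule successively_mono) auto

text \<open>Asymmetry keeps a directed walk from going straight back, so each vertex put in front is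
  new.\<close>

lemma forest_arc_walk_distinct:
  assumes "forest A" and "arc_walk A p"
  shows "distinct p"
  using assms(2)
proof (induction p)
  case (Cons a p)
  show ?case
  proof (cases p rule: remdups_adj.cases)
    case (3 b c q)
    then have "a \<noteq> c" using Cons.prems forest_asym[OF assms(1)] by auto
    then show ?thesis
      using Cons 3 forest_semiwalk_Cons[OF assms(1), of b c q a] arc_walk_semiwalk[of A "a # p"] by auto
  qed (use Cons forest_asym[OF assms(1)] in auto)
qed simp

text \<open>The first backward edge of a semipath beginning with \<open>(a, b)\<close> meets a
  forward edge, and both end in their common vertex. Conversely, a walk that reaches a vertex with
  two incoming edges can turn back there along the other one; the forest condition keeps the
  vertices distinct.\<close>

lemma forest_turning_semiwalk_iff:
  assumes "forest A" and "(a, b) \<in> A"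
  shows "(\<exists>p. distinct (a # b # p) \<and> semiwalk A (a # b # p) \<and> \<not> arc_walk A (a # b # p)) \<longleftrightarrow>
    (\<exists>w. arc_walk A (a # b # w) \<and> joins A (last (b # w)))" (is "?L \<longleftrightarrow> ?R")
proof
  assume ?L
  then obtain p where "distinct (a # b # p)" "semiwalk A (a # b # p)" "\<not> arc_walk A (a # b # p)"
    by blast
  then show ?R
    using assms(2)
  proof (induction p arbitrary: a b)
    case (Cons c p)
    show ?case
    proof (cases "(b, c) \<in> A")
      case True
      then obtain w where "arc_walk A (b # c # w)" "joins A (last (c # w))"
        using Cons by fastforce
      then show ?thesis using Cons.prems by (intro exI[of _ "c # w"]) auto
    next
      case False
      then have "joins A b" using Cons.prems unfolding joins_def by auto
      then show ?thesis using Cons.prems by (intro exI[of _ "[]"]) auto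
    qed
  qed simp
next
  assume ?R
  then obtain w where "arc_walk A (a # b # w)" "joins A (last (b # w))" by blast
  then show ?L
  proof (induction w arbitrary: a b)
    case Nil
    then have ab: "(a, b) \<in> A" by simp
    from Nil have "joins A b" by simp
    then obtain c where c: "c \<noteq> a" "(c, b) \<in> A" unfolding joins_def by metis
    then have "distinct [a, b, c]" "(b, c) \<notin> A" using ab forest_asym[OF assms(1)] by auto
    then show ?case using ab c by (intro exI[of _ "[c]"]) auto
  next
    case (Cons c w)
    then obtain p where p: "distinct (b # c # p)" "semiwalk A (b # c # p)" "\<not> arc_walk A (b # c # p)"
      by fastforce
    have "a \<noteq> c" using Cons.prems forest_asym[OF assms(1)] by auto
    moreover have "semiwalk A (a # b # c # p)" using p Cons.prems by auto
    ultimately show ?case using p forest_semiwalk_Cons[OF assms(1), of b c p a]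
      by (intro exI[of _ "c # p"]) auto
  qed
qed

lemma arc_walk_append_overlap:
  "arc_walk A (u @ a # b # w) \<longleftrightarrow> arc_walk A (u @ [a, b]) \<and> arc_walk A (a # b # w)"
  by (auto simp: successively_append_iff)

text \<open>Being a thread puts one condition on the part up to \<open>b\<close> and another on the
  part from \<open>a\<close> on. Hence threads through a common edge can swap their ends.\<close>

lemma thread_exchange:
  assumes "thread A (u @ a # b # w)" and "thread A (u' @ a # b # w')"
  shows "thread A (u @ a # b # w')"
proof -
  have "hd (u @ a # b # w') = hd (u @ a # b # w)" by (cases u) auto
  then show ?thesis
    using assms arc_walk_append_overlap[of A u a b w] arc_walk_append_overlap[of A u' a b w']
      arc_walk_append_overlap[of A u a b w']
    unfolding thread_def by auto
qed

text \<open>The first vertex of a longest semipath lies on a single edge: a second edge there would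
  lengthen the semipath, as it cannot close a semicycle.\<close>

lemma forest_leaf:
  assumes "forest F" and "finite F" and "F \<noteq> {}"
  shows "\<exists>e\<in>F. \<exists>v\<in>{fst e, snd e}. \<forall>f\<in>F. v \<in> {fst f, snd f} \<longrightarrow> f = e"
proof -
  \<comment> \<open>Keeping \<open>p\<close> within the endpoints of \<open>F\<close> bounds its
    length, so that a longest one exists.\<close>
  define P where "P p \<longleftrightarrow> distinct p \<and> length p \<ge> 2 \<and> semiwalk F p \<and> set p \<subseteq> fst ` F \<union> snd ` F" for p
  obtain a b where "(a, b) \<in> F" using assms(3) by auto
  then have "P [a, b]" using forest_asym[OF assms(1)] unfolding P_def by force
  moreover have "length p < Suc (card (fst ` F \<union> snd ` F))" if "P p" for p
    using that assms(2) distinct_card[of p] card_mono[of "fst ` F \<union> snd ` F" "set p"]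
    unfolding P_def by auto
  ultimately obtain p where p: "P p" and max: "\<And>q. P q \<Longrightarrow> length q \<le> length p"
    using ex_has_greatest_nat[of P "[a, b]" length] by (metis less_imp_le)
  obtain v u r where vur: "p = v # u # r"
    using p unfolding P_def by (cases p rule: remdups_adj.cases) auto
  obtain e where e: "e \<in> F" "e = (v, u) \<or> e = (u, v)"
    using p vur unfolding P_def by auto
  have "f = e" if f: "f \<in> F" "v \<in> {fst f, snd f}" for f
  proof (rule ccontr)
    assume "f \<noteq> e"
    obtain w where w: "f = (v, w) \<or> f = (w, v)" using f by (metis insertE prod.collapse singletonD)
    have "w \<noteq> u" using \<open>f \<noteq> e\<close> e w f forest_asym[OF assms(1)] by auto
    moreover have "semiwalk F (w # v # u # r)" using p vur w f unfolding P_def by auto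
    ultimately have "w \<notin> set p"
      using forest_semiwalk_Cons[OF assms(1), of v u r w] p vur unfolding P_def by simp
    moreover have "w \<in> fst ` F \<union> snd ` F" using w f by force
    ultimately have "P (w # p)"
      using p vur \<open>semiwalk F (w # v # u # r)\<close> unfolding P_def by auto
    then show False using max by fastforce
  qed
  moreover have "v \<in> {fst e, snd e}" using e(2) by force
  ultimately show ?thesis using e(1) by blast
qed

section \<open>Poles and coherent colourings of edges\<close>

fun opposite :: "pole \<Rightarrow> pole" where
  "opposite North = South"
| "opposite South = North"

lemma opposite_neq: "Y \<noteq> Z \<longleftrightarrow> Y = opposite Z"
  by (cases Y; cases Z) auto

lemma opposite_eq_iff [simp]: "opposite Y = opposite Z \<longleftrightarrow> Y = Z" "opposite Y \<noteq> Y" "Y \<noteq> opposite Y"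
  by (cases Y; cases Z; auto)+

text \<open>
  If \<open>\<kappa>\<close> colours the transversal edges, then \<open>mark \<kappa> v e\<close> is the pole that has to select
  the edge \<open>e\<close> at its end \<open>v\<close>.
\<close>

definition mark :: "('a \<times> 'a \<Rightarrow> pole) \<Rightarrow> 'a \<Rightarrow> 'a \<times> 'a \<Rightarrow> pole" where
  "mark \<kappa> v e = (if fst e = v then \<kappa> e else opposite (\<kappa> e))"

text \<open>In a loop-free relation, injectivity of the marks means different colours for two edges
  with a common tail or a common head, and equal colours for an edge ending in \<open>v\<close> and
  one beginning in \<open>v\<close>.\<close>

definition coherent :: "('a \<times> 'a) set \<Rightarrow> ('a \<times> 'a \<Rightarrow> pole) \<Rightarrow> bool" where
  "coherent F \<kappa> \<longleftrightarrow> (\<forall>v. inj_on (mark \<kappa> v) {e \<in> F. v \<in> {fst e, snd e}})"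

text \<open>Pigeonhole: the marks at \<open>v\<close> are distinct, and there are only two
  poles.\<close>

lemma coherent_at_most_two:
  assumes "coherent F \<kappa>" and "{e, f, g} \<subseteq> F" and "distinct [e, f, g]"
    and "\<forall>h\<in>{e, f, g}. v = fst h \<or> v = snd h"
  shows False
proof -
  have "inj_on (mark \<kappa> v) {e, f, g}"
    using assms(1)[unfolded coherent_def, rule_format, of v]
    by (rule inj_on_subset) (use assms(2,4) in auto)
  then have "mark \<kappa> v e \<noteq> mark \<kappa> v f" "mark \<kappa> v e \<noteq> mark \<kappa> v g" "mark \<kappa> v f \<noteq> mark \<kappa> v g"
    using assms(3) by (simp_all add: inj_on_eq_iff)
  then show False by (metis pole.exhaust)
qed

text \<open>By induction, the forest without an edge \<open>e\<close> that has a free end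
  \<open>v\<close> is coloured. At the other end \<open>u\<close> at most one further edge is left,
  so one of the two poles is still available for \<open>e\<close>.\<close>

lemma forest_coherent:
  assumes "finite F" and "forest F"
    and "\<And>e f g v. {e, f, g} \<subseteq> F \<Longrightarrow> distinct [e, f, g] \<Longrightarrow>
           \<forall>h\<in>{e, f, g}. v = fst h \<or> v = snd h \<Longrightarrow> False"
  shows "\<exists>\<kappa>. coherent F \<kappa>"
  using assms
proof (induction F rule: finite_psubset_induct)
  case (psubset F)
  show ?case
  proof (cases "F = {}")
    case True
    then show ?thesis unfolding coherent_def by auto
  next
    case False
    then obtain e v where e: "e \<in> F" "v \<in> {fst e, snd e}"
      and leaf: "\<And>f. f \<in> F \<Longrightarrow> v \<in> {fst f, snd f} \<Longrightarrow> f = e"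
      using forest_leaf[OF psubset.prems(1) psubset.hyps] by blast
    let ?F = "F - {e}"
    have "?F \<subset> F" using e by blast
    moreover have "forest ?F" using psubset.prems(1) forest_subset by blast
    moreover have False
      if "{d, f, g} \<subseteq> ?F" "distinct [d, f, g]" "\<forall>h\<in>{d, f, g}. x = fst h \<or> x = snd h" for d f g x
      using psubset.prems(2)[OF _ that(2,3)] that(1) by blast
    ultimately obtain \<kappa> where \<kappa>: "coherent ?F \<kappa>"
      using psubset.IH[of ?F] by presburger
    obtain u where u: "e = (u, v) \<or> e = (v, u)" using e by (metis insertE prod.collapse singletonD)
    have "u \<noteq> v" using u e forest_asym[OF psubset.prems(1)] by auto
    obtain z where z: "\<And>g. g \<in> ?F \<Longrightarrow> u \<in> {fst g, snd g} \<Longrightarrow> mark \<kappa> u g \<noteq> z"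
    proof (cases "\<exists>g\<in>?F. u \<in> {fst g, snd g}")
      case True
      then obtain g where g: "g \<in> ?F" "u \<in> {fst g, snd g}" by blast
      have "h = g" if h: "h \<in> ?F" "u \<in> {fst h, snd h}" for h
      proof (rule ccontr)
        assume "h \<noteq> g"
        then show False
          by (intro psubset.prems(2)[of e g h u]) (use e(1) g h u in auto)
      qed
      then show ?thesis using that[of "opposite (mark \<kappa> u g)"] by auto
    qed (use that in blast)
    \<comment> \<open>The colour of \<open>e\<close> is the one that makes its mark at
      \<open>u\<close> equal to \<open>z\<close>.\<close>
    define \<kappa>' where "\<kappa>' = \<kappa>(e := if fst e = u then z else opposite z)"
    have mark_e: "mark \<kappa>' u e = z"
      unfolding mark_def \<kappa>'_def using opposite_neq by (auto split: if_splits)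
    have mark_F: "mark \<kappa>' x g = mark \<kappa> x g" if "g \<in> ?F" for x g
      using that unfolding mark_def \<kappa>'_def by simp
    have new: "mark \<kappa>' x e \<noteq> mark \<kappa>' x g"
      if "x \<in> {fst e, snd e}" "g \<in> ?F" "x \<in> {fst g, snd g}" for x g
    proof -
      \<comment> \<open>At \<open>v\<close> there is no edge besides \<open>e\<close>, so a clash
        could only occur at \<open>u\<close>.\<close>
      have "x = u" using that u leaf[of g] by auto
      then show ?thesis using mark_e mark_F z that by metis
    qed
    have old: "g = h" if "g \<in> ?F" "h \<in> ?F" "x \<in> {fst g, snd g}" "x \<in> {fst h, snd h}"
      "mark \<kappa>' x g = mark \<kappa>' x h" for x g h
      by (rule inj_onD[OF \<kappa>[unfolded coherent_def, rule_format, of x]])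
        (use that mark_F[of g x] mark_F[of h x] in simp_all)
    have "coherent F \<kappa>'"
      unfolding coherent_def inj_on_def
    proof (intro allI ballI impI)
      fix x g h
      assume "g \<in> {e \<in> F. x \<in> {fst e, snd e}}" "h \<in> {e \<in> F. x \<in> {fst e, snd e}}"
        "mark \<kappa>' x g = mark \<kappa>' x h"
      then show "g = h"
        using new[of x g] new[of x h] old[of g h x] by (cases "g = e"; cases "h = e") auto
    qed
    then show ?thesis by blast
  qed
qed

lemma card_ge_2_iff:
  assumes "finite B"
  shows "2 \<le> card B \<longleftrightarrow> (\<exists>x\<in>B. \<exists>y\<in>B. x \<noteq> y)"
  using card_le_Suc0_iff_eq[OF assms] by (auto simp: not_less_eq_eq numeral_2_eq_2)

text \<open>Here \<open>B\<close> stands for the edges on one side of a vertex, \<open>T\<close> for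
  the transversal edges and \<open>m\<close> for the marks. A single edge has to be selected by both
  poles, so the marks are prescribed only when there are at least two edges.\<close>

lemma pole_choice:
  fixes m :: "'b \<Rightarrow> pole"
  assumes "finite B" and "B \<noteq> {}" and "inj_on m (B \<inter> T)"
  shows "\<exists>f. (\<forall>Y. f Y \<in> B) \<and>
    (2 \<le> card B \<longrightarrow> f North \<noteq> f South \<and> (\<forall>e\<in>B \<inter> T. f (m e) = e))"
proof (cases "2 \<le> card B")
  case False
  moreover obtain b where "b \<in> B" using assms(2) by blast
  ultimately show ?thesis by (intro exI[of _ "\<lambda>_. b"]) simp
next
  case True
  \<comment> \<open>\<open>B \<inter> T\<close> has at most two elements because there are two
    poles. They are completed to a pair of elements of \<open>B\<close>, of which \<open>Z\<close>
    will select \<open>a\<close> and the other pole \<open>b\<close>.\<close>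
  obtain a Z b where ab: "a \<in> B" "b \<in> B" "a \<noteq> b"
    and T: "\<forall>e\<in>B \<inter> T. e = a \<and> m e = Z \<or> e = b \<and> m e \<noteq> Z"
  proof (cases "\<exists>a\<in>B \<inter> T. \<exists>b\<in>B \<inter> T. a \<noteq> b")
    case True
    then obtain a b where *: "a \<in> B \<inter> T" "b \<in> B \<inter> T" "a \<noteq> b" by blast
    then have "m a \<noteq> m b" using assms(3) by (auto simp: inj_on_def)
    then have "e = a \<or> e = b" if "e \<in> B \<inter> T" for e
      using * that assms(3) by (metis inj_on_def pole.exhaust)
    then have "\<forall>e\<in>B \<inter> T. e = a \<and> m e = m a \<or> e = b \<and> m e \<noteq> m a"
      using \<open>m a \<noteq> m b\<close> by metis
    then show ?thesis using that[of a b "m a"] * by blast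
  next
    case single: False
    show ?thesis
    proof (cases "B \<inter> T = {}")
      case True
      then show ?thesis using that \<open>2 \<le> card B\<close> card_ge_2_iff[OF assms(1)] by blast
    next
      case False
      then obtain a where a: "a \<in> B \<inter> T" by blast
      obtain b where "b \<in> B" "b \<noteq> a" using \<open>2 \<le> card B\<close> card_ge_2_iff[OF assms(1)] by metis
      moreover have "e = a" if "e \<in> B \<inter> T" for e using a single that by blast
      ultimately show ?thesis using a that[of a b "m a"] by (metis IntD1)
    qed
  qed
  define f where "f = (\<lambda>Y. if Y = Z then a else b)"
  have "f Y \<in> B" for Y using ab unfolding f_def by simp
  moreover have "f North \<noteq> f South" using ab unfolding f_def by (cases Z) auto
  moreover have "f (m e) = e" if "e \<in> B \<inter> T" for e using T that unfolding f_def by auto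
  ultimately show ?thesis by blast
qed

section \<open>Transversal edges and threads of an asemicyclic oriented graph\<close>

locale asemicyclic_oriented_graph =
  fixes D :: "'a pair_pre_digraph"
  assumes oriented: "oriented_graph D" and asemi: "asemicyclic D"
begin

lemma pair_digraph: "pair_digraph D"
  using oriented unfolding oriented_graph_def by simp

sublocale pair_digraph D
  by (rule pair_digraph)

lemma arcs_verts: "(a, b) \<in> parcs D \<Longrightarrow> a \<in> pverts D \<and> b \<in> pverts D"
  using in_arcsD1 in_arcsD2 by auto

lemma semiwalk_verts: "semiwalk (parcs D) p \<Longrightarrow> length p \<ge> 2 \<Longrightarrow> set p \<subseteq> pverts D"
proof (induction p)
  case (Cons a p)
  then show ?case using arcs_verts by (cases p rule: remdups_adj.cases) auto
qed simp

lemma forest_arcs: "forest (parcs D)"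
proof -
  have "semicycle D p" if "semiwalk (parcs D) p" "hd p = last p" "length p \<ge> 4" "distinct (butlast p)" for p
    using that semiwalk_verts[of p] unfolding semicycle_def adjacent_seq_def by auto
  then show ?thesis
    using oriented asemi unfolding forest_def oriented_graph_def asemicyclic_def by blast
qed

lemmas arcs_asym = forest_asym[OF forest_arcs]

lemma semipath_iff: "length p \<ge> 2 \<Longrightarrow> semipath D p \<longleftrightarrow> semiwalk (parcs D) p \<and> distinct p"
  using semiwalk_verts[of p] unfolding semipath_def adjacent_seq_def by auto

lemma dipath_arc_walk: "arc_walk (parcs D) p \<Longrightarrow> length p \<ge> 2 \<Longrightarrow> dipath D p"
  using semipath_iff[of p] forest_arc_walk_distinct[OF forest_arcs] arc_walk_semiwalk
  unfolding dipath_def by blast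

text \<open>A proper semipath starting with \<open>a, b\<close> has to turn, which yields the part
  of the thread after the edge. One starting with \<open>b, a\<close> yields the part before it:
  this is the same situation in the converse relation, read backwards.\<close>

lemma transversal_edge_iff:
  "transversal_edge D (a, b) \<longleftrightarrow> (\<exists>u w. thread (parcs D) (u @ a # b # w))"
proof (cases "(a, b) \<in> parcs D")
  case False
  then show ?thesis unfolding thread_def by (auto simp: successively_append_iff)
next
  case ab: True
  let ?A = "parcs D"
  \<comment> \<open>By asymmetry the edge \<open>(a, b)\<close> keeps the cognate from being a path,
    so properness only excludes that the semipath itself is one.\<close>
  have "proper_semipath D (a # b # p) \<longleftrightarrow>
      distinct (a # b # p) \<and> semiwalk ?A (a # b # p) \<and> \<not> arc_walk ?A (a # b # p)" for p
    using ab arcs_asym[OF ab] semipath_iff[of "a # b # p"]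
    unfolding proper_semipath_def dipath_def successively_rev by auto
  then have E: "(\<exists>p. proper_semipath D (a # b # p)) \<longleftrightarrow>
      (\<exists>w. arc_walk ?A (a # b # w) \<and> joins ?A (last (b # w)))"
    using forest_turning_semiwalk_iff[OF forest_arcs ab] by simp
  have "proper_semipath D (b # a # p) \<longleftrightarrow>
      distinct (b # a # p) \<and> semiwalk (?A\<inverse>) (b # a # p) \<and> \<not> arc_walk (?A\<inverse>) (b # a # p)" for p
    using ab arcs_asym[OF ab] semipath_iff[of "b # a # p"] semipath_iff[of "rev (b # a # p)"]
    unfolding proper_semipath_def dipath_def successively_rev by (auto simp: disj_commute)
  then have "(\<exists>p. proper_semipath D (b # a # p)) \<longleftrightarrow>
      (\<exists>w. arc_walk (?A\<inverse>) (b # a # w) \<and> joins (?A\<inverse>) (last (a # w)))"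
    using forest_turning_semiwalk_iff[OF forest_converse[OF forest_arcs], of b a] ab by simp
  also have "\<dots> \<longleftrightarrow> (\<exists>w. arc_walk ?A (rev (b # a # w)) \<and> joins (?A\<inverse>) (last (a # w)))"
    unfolding successively_rev by simp
  also have "\<dots> \<longleftrightarrow> (\<exists>w. arc_walk ?A (rev w @ [a, b]) \<and> joins (?A\<inverse>) (hd (rev w @ [a, b])))"
  proof -
    have "last (a # w) = hd (rev w @ [a, b])" for w :: "'a list"
      by (cases w rule: rev_cases) auto
    then show ?thesis by simp
  qed
  also have "\<dots> \<longleftrightarrow> (\<exists>u. arc_walk ?A (u @ [a, b]) \<and> joins (?A\<inverse>) (hd (u @ [a, b])))"
    by (metis rev_rev_ident)
  finally have W: "(\<exists>p. proper_semipath D (b # a # p)) \<longleftrightarrow>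
    (\<exists>u. arc_walk ?A (u @ [a, b]) \<and> joins (?A\<inverse>) (hd (u @ [a, b])))" .
  have "thread ?A (u @ a # b # w) \<longleftrightarrow>
     (arc_walk ?A (u @ [a, b]) \<and> joins (?A\<inverse>) (hd (u @ [a, b]))) \<and>
     (arc_walk ?A (a # b # w) \<and> joins ?A (last (b # w)))" for u w
  proof -
    have "hd (u @ a # b # w) = hd (u @ [a, b])" by (cases u) auto
    then show ?thesis using arc_walk_append_overlap[of ?A u a b w] unfolding thread_def by auto
  qed
  then show ?thesis using ab E W by auto
qed

lemma finite_arcs_at: "finite (in_arcs D a)" "finite (out_arcs D a)"
  by (auto simp: in_arcs_def out_arcs_def)

lemma joins_in_degree: "joins (parcs D) a \<longleftrightarrow> 2 \<le> in_degree D a"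
  unfolding in_degree_def card_ge_2_iff[OF finite_arcs_at(1)] joins_def by (auto simp: in_arcs_def)

lemma joins_out_degree: "joins ((parcs D)\<inverse>) a \<longleftrightarrow> 2 \<le> out_degree D a"
  unfolding out_degree_def card_ge_2_iff[OF finite_arcs_at(2)] joins_def by (auto simp: out_arcs_def)

lemma inner_vertex_iff: "inner_vertex D a \<longleftrightarrow> (\<exists>b. (b, a) \<in> parcs D) \<and> (\<exists>c. (a, c) \<in> parcs D)"
  unfolding inner_vertex_def W_vertex_def E_vertex_def
  using arcs_verts by (auto simp: in_arcs_def out_arcs_def)

text \<open>Two edges ending in an E-vertex, or beginning in a W-vertex, would contradict
  functionality.\<close>

lemma inner_if_joins:
  assumes "W_E_functional D"
  shows "joins (parcs D) a \<Longrightarrow> inner_vertex D a" "joins ((parcs D)\<inverse>) a \<Longrightarrow> inner_vertex D a"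
proof -
  show "inner_vertex D a" if joins: "joins (parcs D) a"
  proof -
    obtain u v where uv: "u \<noteq> v" "(u, a) \<in> parcs D" "(v, a) \<in> parcs D"
      using joins unfolding joins_def by blast
    then have "\<not> E_vertex D a" using assms unfolding W_E_functional_def by metis
    then show ?thesis using uv arcs_verts unfolding inner_vertex_def W_vertex_def in_arcs_def by auto
  qed
  show "inner_vertex D a" if joins: "joins ((parcs D)\<inverse>) a"
  proof -
    obtain u v where uv: "u \<noteq> v" "(a, u) \<in> parcs D" "(a, v) \<in> parcs D"
      using joins unfolding joins_def by blast
    then have "\<not> W_vertex D a" using assms unfolding W_E_functional_def by metis
    then show ?thesis using uv arcs_verts unfolding inner_vertex_def E_vertex_def out_arcs_def by auto
  qed
qed

text \<open>This makes decency available for threads. Between its ends a thread passes through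
  vertices with an edge on either side; the two ends are inner by functionality.\<close>

lemma thread_inner:
  assumes "W_E_functional D" and "thread (parcs D) p" and "a \<in> set p"
  shows "inner_vertex D a"
proof -
  obtain u w where p: "p = u @ a # w" using assms(3) by (meson split_list)
  consider "u = []" | "w = []" | b u' c w' where "u = u' @ [b]" "w = c # w'"
    by (metis list.exhaust rev_exhaust)
  then show ?thesis
  proof cases
    case 3
    then show ?thesis using assms(2) p unfolding thread_def inner_vertex_iff
      by (auto simp: successively_append_iff)
  qed (use assms inner_if_joins p in \<open>auto simp: thread_def\<close>)
qed

end

section \<open>From a local compass to a coherent colouring\<close>

lemma (in asemicyclic_oriented_graph) local_compass_coherent:
  assumes "local_compass_graph D L"
  shows "\<exists>\<kappa>. coherent {e. transversal_edge D e} \<kappa>"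
proof -
  let ?A = "parcs D"
  have WE: "W_E_functional D" and sep: "separates D L"
    and dec: "\<And>p. dipath D p \<Longrightarrow> \<forall>a\<in>set p. inner_vertex D a \<Longrightarrow> decent D L p"
    using assms unfolding local_compass_graph_def by auto
  define first where "first p = (p ! 0, p ! 1)" for p :: "'a list"
  define final where "final p = (p ! (length p - 2), p ! (length p - 1))" for p :: "'a list"
  define starts where "starts Y p \<longleftrightarrow> L Y East (hd p) = first p" for Y p
  define ends where "ends Y p \<longleftrightarrow> L Y West (last p) = final p" for Y p
  \<comment> \<open>By decency each pole selects the edge of the thread at its first or at its last
    vertex; by separation at most one pole does so at each of these vertices. This leaves exactly
    one pole for each end.\<close>
  have ends_iff: "ends Y p \<longleftrightarrow> \<not> starts Y p" and starts_unique: "\<exists>Z. \<forall>Y. starts Y p \<longleftrightarrow> Y = Z"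
    if p: "thread ?A p" for Y p
  proof -
    have len: "length p \<ge> 2" using p unfolding thread_def by simp
    then have "p \<noteq> []" by auto
    have "\<forall>a\<in>set p. inner_vertex D a" using thread_inner[OF WE p] by blast
    moreover have "dipath D p" using p dipath_arc_walk unfolding thread_def by blast
    ultimately have "decent D L p" by (rule dec[rotated])
    then have "starts North p \<or> ends North p" "starts South p \<or> ends South p"
      using len \<open>p \<noteq> []\<close> unfolding decent_def pole_decent_def starts_def ends_def first_def final_def
      by (auto simp: hd_conv_nth last_conv_nth)
    moreover have "L North East (hd p) \<noteq> L South East (hd p)" "L North West (last p) \<noteq> L South West (last p)"
      using sep p inner_if_joins[OF WE] joins_in_degree joins_out_degree
      unfolding separates_def thread_def by (metis side_degree.simps)+
    ultimately have *: "starts North p \<longleftrightarrow> \<not> ends North p" "starts South p \<longleftrightarrow> \<not> ends South p"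
      "starts North p \<longleftrightarrow> \<not> starts South p"
      unfolding starts_def ends_def by metis+
    then show "ends Y p \<longleftrightarrow> \<not> starts Y p" by (cases Y) auto
    show "\<exists>Z. \<forall>Y. starts Y p \<longleftrightarrow> Y = Z" using *(3) by (metis pole.exhaust)
  qed
  have starts_append: "starts Y (u @ a # b # w) \<longleftrightarrow> starts Y (u @ a # b # w')" for Y u a b w w'
    unfolding starts_def first_def by (cases u; cases "tl u") auto
  have ends_append: "ends Y (u @ a # b # w) \<longleftrightarrow> ends Y (u' @ a # b # w)" for Y u u' a b w
  proof -
    have "final (u @ a # b # w) = final (a # b # w)" for u
      unfolding final_def by (auto simp: nth_append)
    moreover have "last (u @ a # b # w) = last (a # b # w)" for u by simp
    ultimately show ?thesis unfolding ends_def by metis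
  qed
  \<comment> \<open>The crossed thread begins like the first thread and ends like the second. As a
    pole ends a thread iff it does not start it, all three have the same starting pole.\<close>
  have exchange: "starts Y (u @ a # b # w) \<longleftrightarrow> starts Y (u' @ a # b # w')"
    if "thread ?A (u @ a # b # w)" "thread ?A (u' @ a # b # w')" for Y u u' a b w w'
    using thread_exchange[OF that] that starts_append ends_append ends_iff by metis
  \<comment> \<open>By \<open>exchange\<close>, all threads through \<open>e\<close> yield the same
    pole.\<close>
  define \<kappa> where "\<kappa> e = (SOME Z. \<exists>u w. thread ?A (u @ fst e # snd e # w) \<and>
      starts Z (u @ fst e # snd e # w))" for e
  have \<kappa>: "starts Y (u @ a # b # w) \<longleftrightarrow> Y = \<kappa> (a, b)" if t: "thread ?A (u @ a # b # w)" for Y u a b w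
  proof -
    obtain Z where Z: "\<And>Y. starts Y (u @ a # b # w) \<longleftrightarrow> Y = Z" using starts_unique[OF t] by blast
    then have "\<exists>u' w'. thread ?A (u' @ a # b # w') \<and> starts Z (u' @ a # b # w')" using t by blast
    then have "\<exists>u' w'. thread ?A (u' @ a # b # w') \<and> starts (\<kappa> (a, b)) (u' @ a # b # w')"
      unfolding \<kappa>_def fst_conv snd_conv by (rule someI)
    then have "starts (\<kappa> (a, b)) (u @ a # b # w)" using exchange t by blast
    then show ?thesis using Z by simp
  qed
  \<comment> \<open>As two edges begin in \<open>v\<close>, the thread can be cut so as to start
    with \<open>(v, c)\<close>.\<close>
  have tail: "L (\<kappa> (v, c)) East v = (v, c)" if t: "transversal_edge D (v, c)" "joins (?A\<inverse>) v" for v c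
  proof -
    obtain u w where "thread ?A (u @ v # c # w)" using t transversal_edge_iff by blast
    then have "thread ?A ([] @ v # c # w)"
      using t unfolding thread_def by (auto simp: successively_append_iff)
    then show ?thesis using \<kappa> unfolding starts_def first_def by fastforce
  qed
  \<comment> \<open>Dually, the thread is cut after \<open>v\<close>, and its last edge is selected
    by the pole that does not select the first one.\<close>
  have head: "L (opposite (\<kappa> (a, v))) West v = (a, v)" if t: "transversal_edge D (a, v)" "joins ?A v" for a v
  proof -
    obtain u w where "thread ?A (u @ a # v # w)" using t transversal_edge_iff by blast
    moreover have "hd (u @ a # v # w) = hd (u @ [a, v])" by (cases u) auto
    ultimately have th: "thread ?A (u @ a # v # [])"
      using t unfolding thread_def by (auto simp: successively_append_iff)
    then have "ends (opposite (\<kappa> (a, v))) (u @ a # v # [])" using \<kappa>[OF th] ends_iff[OF th] by simp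
    then show ?thesis unfolding ends_def final_def by (auto simp: nth_append)
  qed
  \<comment> \<open>The beginning of a thread through \<open>(a, v)\<close> and the end of one
    through \<open>(v, c)\<close> form a thread through both edges, whose starting pole is the
    colour of each.\<close>
  have inout: "\<kappa> (a, v) = \<kappa> (v, c)" if t: "transversal_edge D (a, v)" "transversal_edge D (v, c)" for a v c
  proof -
    obtain u w where 1: "thread ?A (u @ a # v # w)" using t transversal_edge_iff by blast
    obtain u' w' where 2: "thread ?A (u' @ v # c # w')" using t transversal_edge_iff by blast
    have "hd (u @ a # v # w) = hd (u @ a # v # c # w')" by (cases u) auto
    then have th: "thread ?A (u @ a # v # c # w')"
      using 1 2 unfolding thread_def by (auto simp: successively_append_iff)
    then have "thread ?A ((u @ [a]) @ v # c # w')" by simp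
    from \<kappa>[OF this, of "\<kappa> (a, v)"] \<kappa>[OF th, of "\<kappa> (a, v)"] show ?thesis by simp
  qed
  have "coherent {e. transversal_edge D e} \<kappa>"
    unfolding coherent_def inj_on_def
  proof (intro allI ballI impI)
    fix v e f
    assume "e \<in> {e \<in> {e. transversal_edge D e}. v \<in> {fst e, snd e}}"
      and "f \<in> {e \<in> {e. transversal_edge D e}. v \<in> {fst e, snd e}}"
      and eq: "mark \<kappa> v e = mark \<kappa> v f"
    then have t: "transversal_edge D e" "transversal_edge D f"
      and v: "v = fst e \<or> v = snd e" "v = fst f \<or> v = snd f" by auto
    then have A: "e \<in> ?A" "f \<in> ?A" by (cases e; cases f; simp)+
    have loop: "(v, v) \<notin> ?A" using arcs_asym by blast
    consider a b where "e = (v, a)" "f = (v, b)" | a b where "e = (a, v)" "f = (b, v)"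
      | a b where "e = (a, v)" "f = (v, b)" | a b where "e = (v, a)" "f = (b, v)"
      using v by (cases e; cases f) auto
    then show "e = f"
    proof cases
      case 1
      show ?thesis
      proof (rule ccontr)
        assume "e \<noteq> f"
        then have "joins (?A\<inverse>) v" using 1 A unfolding joins_def by auto
        then have "e = L (mark \<kappa> v e) East v" "f = L (mark \<kappa> v f) East v"
          using tail t 1 unfolding mark_def by auto
        then show False using eq \<open>e \<noteq> f\<close> by simp
      qed
    next
      case 2
      show ?thesis
      proof (rule ccontr)
        assume "e \<noteq> f"
        then have "joins ?A v" using 2 A unfolding joins_def by auto
        moreover have "a \<noteq> v" "b \<noteq> v" using 2 A loop by auto
        ultimately have "e = L (mark \<kappa> v e) West v" "f = L (mark \<kappa> v f) West v"
          using head t 2 unfolding mark_def by auto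
        then show False using eq \<open>e \<noteq> f\<close> by simp
      qed
    next
      case 3
      then have "a \<noteq> v" using A loop by auto
      then show ?thesis using 3 eq inout[of a v b] t unfolding mark_def by auto
    next
      case 4
      then have "b \<noteq> v" using A loop by auto
      then show ?thesis using 4 eq inout[of b v a] t unfolding mark_def by auto
    qed
  qed
  then show ?thesis by blast
qed

section \<open>From a coherent colouring to a local compass\<close>

lemma (in asemicyclic_oriented_graph) coherent_local_compass:
  assumes "weakly_connected D" and WE: "W_E_functional D" and "\<exists>a. inner_vertex D a"
    and \<kappa>: "coherent {e. transversal_edge D e} \<kappa>"
  shows "\<exists>L. local_compass_graph D L"
proof -
  let ?A = "parcs D" and ?T = "{e. transversal_edge D e}"
  define arcs_at where "arcs_at X a = (case X of West \<Rightarrow> in_arcs D a | East \<Rightarrow> out_arcs D a)" for X a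
  have fin: "finite (arcs_at X a)" for X a
    unfolding arcs_at_def using finite_arcs_at by (cases X) auto
  have deg: "side_degree D X a = card (arcs_at X a)" for X a
    unfolding arcs_at_def by (cases X) (auto simp: in_degree_def out_degree_def)
  \<comment> \<open>\<open>f Y\<close> is the candidate for \<open>L Y X a\<close>; the last
    condition makes the compass follow the colouring wherever there is a choice.\<close>
  define good where "good X a f \<longleftrightarrow> (\<forall>Y. f Y \<in> arcs_at X a) \<and>
      (2 \<le> card (arcs_at X a) \<longrightarrow> f North \<noteq> f South \<and>
        (\<forall>e\<in>arcs_at X a \<inter> ?T. f (mark \<kappa> a e) = e))" for X a and f :: "pole \<Rightarrow> 'a \<times> 'a"
  have "\<exists>f. inner_vertex D a \<longrightarrow> good X a f" for X a
  proof (cases "inner_vertex D a")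
    case True
    then have "arcs_at X a \<noteq> {}"
      unfolding arcs_at_def inner_vertex_def W_vertex_def E_vertex_def by (cases X) auto
    moreover have "inj_on (mark \<kappa> a) {e \<in> ?T. a \<in> {fst e, snd e}}"
      using \<kappa> unfolding coherent_def by blast
    then have "inj_on (mark \<kappa> a) (arcs_at X a \<inter> ?T)"
      by (rule inj_on_subset) (cases X; auto simp: arcs_at_def in_arcs_def out_arcs_def)
    ultimately show ?thesis using pole_choice[OF fin] unfolding good_def by blast
  qed simp
  note good_ex = this
  define f where "f X a = (SOME f. inner_vertex D a \<longrightarrow> good X a f)" for X a
  have "good X a (f X a)" if "inner_vertex D a" for X a
    using someI_ex[OF good_ex[of a X]] that unfolding f_def by blast
  note f = this[unfolded good_def]
  define L where "L Y X a = f X a Y" for Y X a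
  have "compass_functions D L"
    unfolding compass_functions_def L_def
  proof (intro allI impI)
    fix Y a
    assume "inner_vertex D a"
    then show "f West a Y \<in> in_arcs D a \<and> f East a Y \<in> out_arcs D a"
      using f[of a West] f[of a East] unfolding arcs_at_def by simp
  qed
  moreover have "separates D L"
    unfolding separates_def L_def deg using f by blast
  moreover have "decent D L p" if p: "dipath D p" and inner: "\<forall>a\<in>set p. inner_vertex D a" for p
  proof (cases "length p = 1")
    case True
    then show ?thesis unfolding decent_def pole_decent_def by simp
  next
    case False
    have walk: "arc_walk ?A p" and "p \<noteq> []"
      using p unfolding dipath_def semipath_def adjacent_seq_def by auto
    with False have len: "length p \<ge> 2" by (cases p rule: remdups_adj.cases) auto
    let ?n = "length p"
    let ?x = "p ! 0" and ?y = "p ! (?n - 1)"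
    let ?e = "(p ! 0, p ! 1)" and ?f = "(p ! (?n - 2), p ! (?n - 1))"
    have arc: "(p ! i, p ! Suc i) \<in> ?A" if "Suc i < ?n" for i
      using walk that by (auto simp: successively_conv_nth)
    have eA: "?e \<in> arcs_at East ?x" using arc[of 0] len unfolding arcs_at_def by (auto simp: out_arcs_def)
    have "?n - 1 = Suc (?n - 2)" using len by simp
    then have fA: "?f \<in> arcs_at West ?y"
      using arc[of "?n - 2"] len unfolding arcs_at_def by (auto simp: in_arcs_def)
    have "?x \<in> set p" "?y \<in> set p" using \<open>p \<noteq> []\<close> by simp_all
    then have xy: "inner_vertex D ?x" "inner_vertex D ?y" using inner by blast+
    \<comment> \<open>If one of the two ends offers a single edge, both poles select it there.
      Otherwise \<open>p\<close> is a thread, and the colouring decides.\<close>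
    have "L Y East ?x = ?e \<or> L Y West ?y = ?f" for Y
    proof (cases "2 \<le> card (arcs_at East ?x) \<and> 2 \<le> card (arcs_at West ?y)")
      case False
      then have "(\<forall>g\<in>arcs_at East ?x. \<forall>h\<in>arcs_at East ?x. g = h) \<or>
          (\<forall>g\<in>arcs_at West ?y. \<forall>h\<in>arcs_at West ?y. g = h)"
        using card_ge_2_iff[OF fin] by blast
      then show ?thesis using eA fA f xy unfolding L_def by metis
    next
      case True
      then have "joins (?A\<inverse>) (hd p)" "joins ?A (last p)"
        using \<open>p \<noteq> []\<close> unfolding joins_in_degree joins_out_degree arcs_at_def
        by (simp_all add: hd_conv_nth last_conv_nth in_degree_def out_degree_def)
      then have thread: "thread ?A p" using walk len unfolding thread_def by simp
      have T: "(p ! i, p ! Suc i) \<in> ?T" if "Suc i < ?n" for i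
      proof -
        have "p = take i p @ p ! i # p ! Suc i # drop (Suc (Suc i)) p"
          using that by (metis Cons_nth_drop_Suc Suc_lessD append_take_drop_id)
        then show ?thesis using thread transversal_edge_iff[of "p ! i" "p ! Suc i"] by (metis mem_Collect_eq)
      qed
      \<comment> \<open>Coherence gives consecutive edges the same colour, which is thus carried
        along the whole thread.\<close>
      have "\<kappa> (p ! i, p ! Suc i) = \<kappa> ?e" if "Suc i < ?n" for i
        using that
      proof (induction i)
        case (Suc i)
        let ?g = "(p ! i, p ! Suc i)" and ?h = "(p ! Suc i, p ! Suc (Suc i))"
        have "p ! i \<noteq> p ! Suc i" using arc[of i] Suc.prems arcs_asym by (metis Suc_lessD)
        moreover from this have "?g \<noteq> ?h" by simp
        then have "mark \<kappa> (p ! Suc i) ?g \<noteq> mark \<kappa> (p ! Suc i) ?h"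
          using inj_onD[OF \<kappa>[unfolded coherent_def, rule_format, of "p ! Suc i"], of ?g ?h]
            T[of i] T[of "Suc i"] Suc.prems by fastforce
        ultimately have "\<kappa> ?g = \<kappa> ?h" unfolding mark_def by (auto simp: opposite_neq)
        then show ?case using Suc by simp
      qed simp
      from this[of "?n - 2"] have \<kappa>_eq: "\<kappa> ?f = \<kappa> ?e" using len \<open>?n - 1 = Suc (?n - 2)\<close> by simp
      have "?e \<in> ?T" "?f \<in> ?T" using T[of 0] T[of "?n - 2"] len \<open>?n - 1 = Suc (?n - 2)\<close> by auto
      \<comment> \<open>The mark of the first edge at \<open>?x\<close> is the common colour, that
        of the last edge at \<open>?y\<close> is its opposite. So each pole is served at one of the
        ends.\<close>
      then have "L (mark \<kappa> ?x ?e) East ?x = ?e" "L (mark \<kappa> ?y ?f) West ?y = ?f"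
        using f[OF xy(1), of East] f[OF xy(2), of West] True eA fA unfolding L_def by blast+
      moreover have "p ! (?n - 2) \<noteq> ?y"
        using arc[of "?n - 2"] len \<open>?n - 1 = Suc (?n - 2)\<close> arcs_asym by force
      ultimately show ?thesis using \<kappa>_eq opposite_neq[of Y "\<kappa> ?e"] unfolding mark_def by auto
    qed
    then show ?thesis using xy len unfolding decent_def pole_decent_def by simp
  qed
  ultimately show ?thesis
    using assms oriented asemi unfolding local_compass_graph_def by blast
qed

theorem proposition5p2:
  fixes D :: "'a pair_pre_digraph"
  assumes "oriented_graph D"
  shows "local_K_graph D \<longleftrightarrow> K_graph D"
\<comment> \<open>With a semicycle both sides fail; without one the locale can be entered.\<close>
proof (cases "asemicyclic D")
  case False
  then show ?thesis unfolding local_K_graph_def local_compass_graph_def K_graph_def by blast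
next
  case True
  interpret asemicyclic_oriented_graph D using assms True by unfold_locales
  let ?T = "{e. transversal_edge D e}"
  have sub: "?T \<subseteq> parcs D" by auto
  show ?thesis
  proof
    assume "local_K_graph D"
    then obtain L where L: "local_compass_graph D L" unfolding local_K_graph_def by blast
    then obtain \<kappa> where "coherent ?T \<kappa>" using local_compass_coherent by blast
    then have "\<not> transversal_bifurcation D e f g" for e f g
      using coherent_at_most_two[of ?T \<kappa> e f g] unfolding transversal_bifurcation_def bifurcation_def by blast
    then show "K_graph D" using L unfolding K_graph_def local_compass_graph_def by blast
  next
    assume K: "K_graph D"
    have "\<exists>\<kappa>. coherent ?T \<kappa>"
    proof (rule forest_coherent)
      show "finite ?T" by (rule finite_subset[OF sub]) (use finite_arcs in simp)
      show "forest ?T" using sub forest_arcs forest_subset by blast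
      show False if "{e, f, g} \<subseteq> ?T" "distinct [e, f, g]" "\<forall>h\<in>{e, f, g}. v = fst h \<or> v = snd h" for e f g v
      proof -
        have "transversal_bifurcation D e f g"
          using that sub unfolding transversal_bifurcation_def bifurcation_def by blast
        then show False using K unfolding K_graph_def by blast
      qed
    qed
    then show "local_K_graph D"
      using K coherent_local_compass unfolding K_graph_def local_K_graph_def by blast
  qed
qed

end
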